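(* Let $k\in\{1,\dots,n-1\}$ and let $H$ be an $(n-k)$-dimensional linear subspace of $\mathbb{R}^n$. Let $\phi_i:\mathbb{R}^i\to[0,\infty)$, $i=n-k,k$, be functions with $\|\phi_i\|_\infty=\phi_i(0)$, and such that the function $\phi:\mathbb{R}^n\to[0,\infty)$ given by $\phi(x,y)=\phi_{n-k}(x)\phi_k(y)$, $x\in\mathbb{R}^{n-k}$, $y\in\mathbb{R}^k$, is quasi-concave. Let $\mu_n=\mu_{n-k}\times\mu_k$ be the product measure on $\mathbb{R}^n$ given by $d\mu_{n-k}(x)=\phi_{n-k}(x)\,dx$ and $d\mu_k(y)=\phi_k(y)\,dy$. Let $K\subset\mathbb{R}^n$ be a convex body with $P_HK\subset K$ and such that $\mathrm{vol}_k\bigl(\mathcal{C}_t(\phi)\cap K\cap(x+H^\perp)\bigr)$, as a function of $x\in H$, attains its maximum for all $t\in(0,1)$. Then $$\mu_{n-k}(P_HK)\,\max_{x_0\in H}\left[\frac{\phi_{n-k}(x_0)}{\|\phi_{n-k}\|_\infty}\,\mu_k\bigl(K\cap(x_0+H^\perp)\bigr)\right]\le\binom{n}{k}\mu_n(K).$$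
   Context: A convex body is a compact convex set with non-empty interior. $P_H$ is orthogonal projection onto $H$, and $H^\perp$ is the orthogonal complement of $H$. Orthonormal coordinates are chosen so that $H$ is identified with $\mathbb{R}^{n-k}$ and $H^\perp$ with $\mathbb{R}^k$, so $\mathbb{R}^n=\mathbb{R}^{n-k}\times\mathbb{R}^k$; $\mu_{n-k}$ acts on subsets of $H$, and $\mu_k\bigl(K\cap(x_0+H^\perp)\bigr)$ means $\mu_k(\{y\in\mathbb{R}^k:(x_0,y)\in K\})$. A function $\phi$ is quasi-concave if $\phi((1-\lambda)z+\lambda w)\ge\min\{\phi(z),\phi(w)\}$ for all $z,w$ and $\lambda\in(0,1)$. $\|\cdot\|_\infty$ is the essential supremum with respect to Lebesgue measure, i.e. $\|\phi\|_\infty=\inf\{t\in\mathbb{R}:\mathrm{vol}(\{\phi>t\})=0\}$, where $\mathrm{vol}$ is Lebesgue measure on the domain of the function. $\mathrm{supp}\,\phi$ is the closure of $\{\phi>0\}$, and $\mathcal{C}_t(\phi)=\{z\in\mathrm{supp}\,\phi:\phi(z)\ge t\|\phi\|_\infty\}$. $\mathrm{vol}_k$ is $k$-dimensional Lebesgue measure.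
   Formalization: The formal theorem additionally assumes φ_{n-k}(x) ≤ φ_{n-k}(0) for every x (with only the essential supremum the claim fails, by changing φ_{n-k} at one point), and the maximum over x_0 is replaced by a supremum, as it need not be attained. *)

theory Defs
  imports "HOL-Analysis.Analysis" "HOL-Probability.Essential_Supremum"
begin

definition convex_body :: "'c::euclidean_space set \<Rightarrow> bool" where
  "convex_body K \<longleftrightarrow> compact K \<and> convex K \<and> interior K \<noteq> {}"

definition orth_proj :: "'c::euclidean_space set \<Rightarrow> 'c \<Rightarrow> 'c" where
  "orth_proj H z = (THE p. p \<in> H \<and> z - p \<in> orthogonal_comp H)"

text \<open>Orthonormal coordinates adapted to a subspace \<open>H\<close>: a linear isometry of the
  product space onto the ambient space, the first factor parametrizing \<open>H\<close> and
  the second one its orthogonal complement. The inner product of the product type is the sum of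
  the inner products of the factors.\<close>

definition orthonormal_coords ::
    "'c::euclidean_space set \<Rightarrow> ('a::euclidean_space \<times> 'b::euclidean_space \<Rightarrow> 'c) \<Rightarrow> bool" where
  "orthonormal_coords H \<iota> \<longleftrightarrow>
     linear \<iota> \<and> (\<forall>p q. \<iota> p \<bullet> \<iota> q = p \<bullet> q) \<and>
     \<iota> ` (UNIV \<times> {0}) = H \<and> \<iota> ` ({0} \<times> UNIV) = orthogonal_comp H"

definition quasi_concave :: "('c::real_vector \<Rightarrow> real) \<Rightarrow> bool" where
  "quasi_concave \<phi> \<longleftrightarrow>
     (\<forall>z w. \<forall>l\<in>{0<..<1}. \<phi> ((1 - l) *\<^sub>R z + l *\<^sub>R w) \<ge> min (\<phi> z) (\<phi> w))"

text \<open>The essential supremum is taken in the extended reals; it is infinite for functions that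
  are not essentially bounded above or not Lebesgue measurable.\<close>

definition linf_norm :: "('c::euclidean_space \<Rightarrow> real) \<Rightarrow> ereal" where
  "linf_norm \<phi> = esssup lebesgue (\<lambda>z. ereal (\<phi> z))"

definition supp :: "('c::topological_space \<Rightarrow> real) \<Rightarrow> 'c set" where
  "supp \<phi> = closure {z. \<phi> z > 0}"

definition level_set :: "real \<Rightarrow> ('c::euclidean_space \<Rightarrow> real) \<Rightarrow> 'c set" where
  "level_set t \<phi> = {z \<in> supp \<phi>. ereal (\<phi> z) \<ge> ereal t * linf_norm \<phi>}"

definition weighted :: "('c::euclidean_space \<Rightarrow> real) \<Rightarrow> 'c measure" where
  "weighted \<phi> = density lebesgue (\<lambda>z. ennreal (\<phi> z))"

text \<open>Coordinates of the fibre of \<open>A\<close> over the point \<open>\<iota> (x, 0)\<close> of \<open>H\<close>, that is, of the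
  intersection of \<open>A\<close> with the translate of the orthogonal complement through that point.\<close>

definition fibre :: "('a \<times> 'b \<Rightarrow> 'c) \<Rightarrow> 'c set \<Rightarrow> 'a \<Rightarrow> 'b set" where
  "fibre \<iota> A x = {y. \<iota> (x, y) \<in> A}"

end

theory Submission
  imports Defs
begin

text \<open>In the given coordinates let \<open>C = \<iota> -` K\<close>, a closed convex set in a product space which
contains its projection \<open>P \<times> {0}\<close>, and let \<open>{x0} \<times> F\<close> be its fibre over a point \<open>x0\<close>.

For constant densities the inequality reads
\<open>vol P * vol F \<le> (n choose k) * vol C\<close>. It holds because \<open>C\<close>, being convex, contains the join of
\<open>P \<times> {0}\<close> and \<open>{x0} \<times> F\<close>, that is, all points \<open>((1 - r) p + r x0, r y)\<close>, and the volume of the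
join is bounded below: over \<open>y \<in> r F\<close> it contains a copy of \<open>P\<close> shrunk by \<open>1 - r\<close>, and integrating
these over \<open>y\<close> gives \<open>vol P * vol F\<close> times a beta integral whose
value is \<open>1 / (n choose k)\<close>. This is
\<open>volume_convex_join_le\<close>.

For general densities \<open>f\<close> and \<open>g\<close> the same estimate is applied to every superlevel set
\<open>L = {z \<in> C. s \<le> f x * g y}\<close>, which is convex by quasi-concavity. Its horizontal slice at height
\<open>0\<close> is \<open>{x \<in> P. s \<le> f x * g 0}\<close>, its vertical slice over \<open>x0\<close> is \<open>{y \<in> F. s \<le> f x0 * g y}\<close>, and
by the layer-cake formula their volumes integrate over \<open>0 < s \<le> f 0 * g 0\<close> to \<open>g 0\<close> times the
weighted measure of \<open>P\<close> and to \<open>f x0\<close> times that of \<open>F\<close>. Both volumes decrease in \<open>s\<close>, so the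
Chebyshev inequality bounds the product of the two integrals by \<open>f 0 * g 0\<close> times the integral of
the product, which the estimate on the levels controls by the weighted measure of \<open>C\<close>. Dividing by
\<open>f 0 * g 0\<close> gives \<open>weighted_rogers_shephard\<close>, from which the theorem follows by taking the supremum
over \<open>x0\<close>.\<close>

section \<open>One-dimensional integrals\<close>

text \<open>The constant of the theorem: \<open>m B(k + 1, m)\<close> is the reciprocal of a binomial coefficient.\<close>

lemma nn_integral_beta_nat:
  fixes m k :: nat
  assumes "m > 0"
  shows "of_nat ((m + k) choose k) *
      (\<integral>\<^sup>+r. ennreal (real m * (1 - r) ^ (m - 1) * r ^ k) * indicator {0<..<1} r \<partial>lborel) = 1"
proof -
  let ?B = "Beta (real k + 1) (real m)"
  have "((\<lambda>t. t powr (real k + 1 - 1) * (1 - t) powr (real m - 1)) has_integral ?B) {0<..<1}"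
    using has_integral_Beta_real[of "real k + 1" "real m"] assms
    by (simp add: has_integral_Icc_iff_Ioo)
  then have "((\<lambda>t. (1 - t) ^ (m - 1) * t ^ k) has_integral ?B) {0<..<1}"
    by (rule has_integral_eq[rotated])
       (use assms in \<open>auto simp: of_nat_diff simp flip: powr_realpow\<close>)
  then have hi: "((\<lambda>t. real m * (1 - t) ^ (m - 1) * t ^ k) has_integral (real m * ?B)) {0<..<1}"
    by (simp add: mult.assoc has_integral_mult_right)
  let ?p = "\<lambda>r. real m * (1 - r) ^ (m - 1) * r ^ k"
  have "(\<integral>\<^sup>+r. ennreal (indicator {0<..<1} r * ?p r) \<partial>lborel) = ennreal (real m * ?B)"
  proof (rule nn_integral_has_integral_lborel)
    have "(\<lambda>r. indicator {0<..<1} r * ?p r) = (\<lambda>r. if r \<in> {0<..<1} then ?p r else 0)"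
      by (auto simp: indicator_def)
    with hi[unfolded has_integral_restrict_UNIV[of "{0<..<1}", symmetric]]
    show "((\<lambda>r. indicator {0<..<1} r * ?p r) has_integral real m * ?B) UNIV"
      by simp
  qed (auto simp: indicator_def)
  then have "(\<integral>\<^sup>+r. ennreal (?p r) * indicator {0<..<1} r \<partial>lborel) = ennreal (real m * ?B)"
    by (simp add: mult.commute[of _ "indicator _ _"] indicator_mult_ennreal)
  moreover have "real m * ?B = 1 / real ((m + k) choose k)"
  proof -
    obtain j where j: "m = Suc j" using assms by (cases m) auto
    have "?B = fact k * fact j / fact (k + m)"
      using Gamma_fact[of k, where 'a=real] Gamma_fact[of j, where 'a=real]
        Gamma_fact[of "k+m", where 'a=real]
      by (simp add: Beta_def j add_ac)
    moreover have "real ((m + k) choose k) = fact (m + k) / (fact k * fact m)"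
      by (simp add: binomial_fact)
    ultimately show ?thesis by (simp add: j add_ac field_simps)
  qed
  ultimately show ?thesis
    by (simp add: ennreal_of_nat_eq_real_of_nat flip: ennreal_mult')
qed

lemma nn_integral_power_tail:
  fixes g :: real
  assumes "0 \<le> g" "g \<le> 1" "m > 0"
  shows "(\<integral>\<^sup>+r\<in>{g..1}. ennreal (real m * (1 - r) ^ (m - 1)) \<partial>lborel) = ennreal ((1 - g) ^ m)"
proof -
  have "(\<integral>\<^sup>+r\<in>{g..1}. ennreal (real m * (1 - r) ^ (m - 1)) \<partial>lborel)
      = ennreal (- ((1 - 1) ^ m) - (- ((1 - g) ^ m)))"
    by (rule nn_integral_FTC_Icc)
       (use assms in \<open>auto intro!: derivative_eq_intros\<close>)
  then show ?thesis using assms by simp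
qed

text \<open>The continuous form of the Chebyshev sum inequality. The functions are similarly ordered, so
  \<open>(f s - f t) (g s - g t) \<ge> 0\<close>; in the form \<open>f s g t + f t g s \<le> f s g s + f t g t\<close> this needs no
  subtraction, holds for infinite values too, and is integrated over \<open>s\<close> and \<open>t\<close>.\<close>

lemma nn_integral_chebyshev_antimono:
  fixes f g :: "real \<Rightarrow> ennreal"
  assumes [measurable]: "f \<in> borel_measurable borel" "g \<in> borel_measurable borel"
    and f: "antimono f" and g: "antimono g" and "T \<ge> 0"
  shows "(\<integral>\<^sup>+s\<in>{0<..T}. f s \<partial>lborel) * (\<integral>\<^sup>+s\<in>{0<..T}. g s \<partial>lborel)
      \<le> ennreal T * (\<integral>\<^sup>+s\<in>{0<..T}. f s * g s \<partial>lborel)"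
proof -
  let ?M = "restrict_space lborel {0<..T}"
  have R: "(\<integral>\<^sup>+s\<in>{0<..T}. h s \<partial>lborel) = (\<integral>\<^sup>+s. h s \<partial>?M)" for h :: "real \<Rightarrow> ennreal"
    by (simp add: nn_integral_restrict_space)
  have [measurable]: "f \<in> borel_measurable ?M" "g \<in> borel_measurable ?M"
    by (auto intro: measurable_restrict_space1)
  have vol: "emeasure ?M (space ?M) = ennreal T"
    using \<open>T \<ge> 0\<close> by (simp add: emeasure_restrict_space)
  have pt: "f s * g t + f t * g s \<le> f s * g s + f t * g t" for s t
  proof -
    have *: "f s * g t + f t * g s \<le> f s * g s + f t * g t" if st: "s \<le> t" for s t
    proof -
      obtain d e where d: "f s = f t + d" and e: "g s = g t + e"
        using antimonoD[OF f st] antimonoD[OF g st] by (metis le_iff_add)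
      have "f s * g s + f t * g t = (f s * g t + f t * g s) + d * e"
        unfolding d e by (simp add: algebra_simps)
      then show ?thesis by simp
    qed
    show ?thesis using *[of s t] *[of t s] by (cases "s \<le> t") (simp_all add: add_ac)
  qed
  have "2 * ((\<integral>\<^sup>+s. f s \<partial>?M) * (\<integral>\<^sup>+s. g s \<partial>?M))
      = (\<integral>\<^sup>+s. \<integral>\<^sup>+t. f s * g t + f t * g s \<partial>?M \<partial>?M)"
    by (simp add: nn_integral_add nn_integral_cmult nn_integral_multc mult_2)
  also have "\<dots> \<le> (\<integral>\<^sup>+s. \<integral>\<^sup>+t. f s * g s + f t * g t \<partial>?M \<partial>?M)"
    by (intro nn_integral_mono pt)
  also have "\<dots> = 2 * (ennreal T * (\<integral>\<^sup>+s. f s * g s \<partial>?M))"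
    using vol by (simp add: nn_integral_add nn_integral_cmult nn_integral_multc mult_2 algebra_simps)
  finally have le: "2 * ((\<integral>\<^sup>+s. f s \<partial>?M) * (\<integral>\<^sup>+s. g s \<partial>?M)) \<le> 2 * (ennreal T * (\<integral>\<^sup>+s. f s * g s \<partial>?M))" .
  have "ennreal (1/2) * (2 * x) = x" for x :: ennreal
    by (metis ennreal_numeral ennreal_mult'  mult.assoc mult_1 ennreal_1
        field_sum_of_halves mult_2_right zero_le_numeral divide_nonneg_nonneg zero_le_one
        distrib_left mult.right_neutral)
  with mult_left_mono[OF le, of "ennreal (1/2)"] show ?thesis unfolding R by simp
qed

text \<open>Write \<open>h x\<close> as the length of \<open>{0<..h x}\<close> and exchange the integrals. Levels above the
  bound \<open>T\<close> contribute nothing.\<close>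

lemma nn_integral_layer_cake:
  fixes h :: "'a::euclidean_space \<Rightarrow> real"
  assumes [measurable]: "h \<in> borel_measurable borel" "S \<in> sets borel"
    and h: "\<And>x. 0 \<le> h x" "\<And>x. h x \<le> T"
  shows "(\<integral>\<^sup>+x\<in>S. ennreal (h x) \<partial>lborel)
       = (\<integral>\<^sup>+s\<in>{0<..T}. emeasure lborel {x\<in>S. s \<le> h x} \<partial>lborel)"
proof -
  have "(\<integral>\<^sup>+x\<in>S. ennreal (h x) \<partial>lborel)
      = (\<integral>\<^sup>+x. \<integral>\<^sup>+s. (if x \<in> S \<and> 0 < s \<and> s \<le> h x then 1 else 0) \<partial>lborel \<partial>lborel)"
  proof (rule nn_integral_cong)
    fix x
    have "ennreal (h x) * indicator S x
        = (\<integral>\<^sup>+s. indicator S x * indicator {0<..h x} s \<partial>lborel)"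
      using h(1)[of x] by (simp add: nn_integral_cmult mult.commute)
    also have "\<dots> = (\<integral>\<^sup>+s. (if x \<in> S \<and> 0 < s \<and> s \<le> h x then 1 else 0) \<partial>lborel)"
      by (intro nn_integral_cong) (auto simp: indicator_def)
    finally show "ennreal (h x) * indicator S x = \<dots>" .
  qed
  also have "\<dots> = (\<integral>\<^sup>+s. \<integral>\<^sup>+x. (if x \<in> S \<and> 0 < s \<and> s \<le> h x then 1 else 0) \<partial>lborel \<partial>lborel)"
    by (rule lborel_pair.Fubini') measurable
  also have "\<dots> = (\<integral>\<^sup>+s\<in>{0<..T}. emeasure lborel {x\<in>S. s \<le> h x} \<partial>lborel)"
  proof (rule nn_integral_cong)
    fix s :: real
    have "(\<integral>\<^sup>+x. (if x \<in> S \<and> 0 < s \<and> s \<le> h x then 1 else 0) \<partial>lborel)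
        = (\<integral>\<^sup>+x. indicator {0<..T} s * indicator {x\<in>S. s \<le> h x} x \<partial>lborel)"
      by (intro nn_integral_cong) (auto simp: indicator_def dest: order_trans[OF _ h(2)])
    also have "\<dots> = emeasure lborel {x\<in>S. s \<le> h x} * indicator {0<..T} s"
      by (subst nn_integral_cmult) (auto simp: mult.commute)
    finally show "(\<integral>\<^sup>+x. (if x \<in> S \<and> 0 < s \<and> s \<le> h x then 1 else 0) \<partial>lborel) = \<dots>" .
  qed
  finally show ?thesis .
qed

section \<open>The volume of a join\<close>

text \<open>Used with \<open>v\<close> the volume of a fibre of the join that contains copies of a set of volume
  \<open>V\<close> shrunk by \<open>1 - r\<close>, for every \<open>r \<in> R\<close>. The best bound, \<open>(1 - Inf R) ^ m * V\<close>, is replaced by an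
  integral over \<open>R\<close>: this is linear in the indicator of \<open>R\<close>, which makes the later exchange of
  integrals possible, and it is no larger since \<open>R\<close> lies to the right of \<open>Inf R\<close>.\<close>

lemma integral_power_le_of_homothety_bounds:
  fixes R :: "real set" and v V :: ennreal
  assumes "m > 0" and R: "R \<subseteq> {0<..<1}"
    and le: "\<And>r. r \<in> R \<Longrightarrow> ennreal ((1 - r) ^ m) * V \<le> v"
  shows "(\<integral>\<^sup>+r. ennreal (real m * (1 - r) ^ (m - 1)) * indicator R r \<partial>lborel) * V \<le> v"
proof (cases "R = {} \<or> v = top")
  case True
  then show ?thesis by auto
next
  case False
  then obtain r0 where r0: "r0 \<in> R" and "v \<noteq> top" by auto
  have bdd: "bdd_below R" using R by (auto intro!: bdd_belowI[of _ 0])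
  define g where "g = Inf R"
  have g: "0 \<le> g" "g \<le> 1" "R \<subseteq> {g..1}"
  proof -
    show "0 \<le> g" using R r0 unfolding g_def by (intro cInf_greatest) auto
    show "g \<le> 1" using R r0 cInf_lower[OF r0 bdd] by (force simp: g_def)
    show "R \<subseteq> {g..1}" using R cInf_lower[OF _ bdd] by (force simp: g_def)
  qed
  have "V \<noteq> top"
    using le[OF r0] R r0 \<open>v \<noteq> top\<close> by (auto simp: ennreal_mult_top top_unique split: if_splits)
  then obtain V' v' where V: "V = ennreal V'" "v = ennreal v'" "V' \<ge> 0" "v' \<ge> 0"
    using \<open>v \<noteq> top\<close> by (metis ennreal_cases)
  \<comment> \<open>The hypothesis survives passage to the limit \<open>r \<rightarrow> Inf R\<close>, because in finite numbers
      it is a closed condition.\<close>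
  have "R \<subseteq> {r. (1 - r) ^ m * V' \<le> v'}"
  proof
    fix r assume r: "r \<in> R"
    with R have "r < 1" by auto
    with le[OF r] V show "r \<in> {r. (1 - r) ^ m * V' \<le> v'}"
      by (simp flip: ennreal_mult')
  qed
  moreover have "closed {r. (1 - r) ^ m * V' \<le> v'}"
    by (intro closed_Collect_le continuous_intros)
  ultimately have "closure R \<subseteq> {r. (1 - r) ^ m * V' \<le> v'}"
    by (rule closure_minimal)
  then have "(1 - g) ^ m * V' \<le> v'"
    using closure_contains_Inf[of R] bdd r0 by (auto simp: g_def)
  then have "ennreal ((1 - g) ^ m) * V \<le> v"
    using V g by (simp flip: ennreal_mult')
  moreover have "(\<integral>\<^sup>+r. ennreal (real m * (1 - r) ^ (m - 1)) * indicator R r \<partial>lborel)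
      \<le> ennreal ((1 - g) ^ m)"
    using g \<open>m > 0\<close>
    by (auto intro!: nn_integral_mono simp: indicator_def subset_iff simp flip: nn_integral_power_tail)
  ultimately show ?thesis by (meson mult_right_mono order_trans zero_le)
qed

lemma emeasure_lborel_homothety:
  fixes S :: "'a::euclidean_space set"
  assumes "S \<in> sets borel" "r > 0"
  shows "emeasure lborel {x. (x - c) /\<^sub>R r \<in> S} = ennreal (r ^ DIM('a)) * emeasure lborel S"
proof -
  have [measurable]: "S \<in> sets borel" by fact
  have "{x. (x - c) /\<^sub>R r \<in> S} = (\<lambda>x. r *\<^sub>R x + c) ` S"
  proof (intro equalityI subsetI)
    fix x assume "x \<in> {x. (x - c) /\<^sub>R r \<in> S}"
    then show "x \<in> (\<lambda>x. r *\<^sub>R x + c) ` S"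
      using \<open>r > 0\<close> by (intro image_eqI[of _ _ "(x - c) /\<^sub>R r"]) auto
  qed (use \<open>r > 0\<close> in auto)
  moreover have "{x. (x - c) /\<^sub>R r \<in> S} \<in> sets borel" by measurable
  ultimately show ?thesis
    using emeasure_lebesgue_affine[of r c S] assms
    by (simp add: emeasure_completion power_abs)
qed

text \<open>Integrate the volumes of the horizontal fibres: the one at height \<open>y\<close> contains a copy of \<open>P\<close>
  shrunk by \<open>1 - r\<close> for every \<open>r\<close> with \<open>y \<in> r F\<close>. Leaving out the ends \<open>r = 0\<close> and \<open>r = 1\<close> of the join
  makes both homotheties invertible and does not change the integrals.\<close>

lemma volume_join_le:
  fixes P :: "'a::euclidean_space set" and F :: "'b::euclidean_space set"
    and D :: "('a \<times> 'b) set"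
  assumes [measurable]: "P \<in> sets borel" "F \<in> sets borel" "D \<in> sets borel"
    and join: "\<And>p y r. p \<in> P \<Longrightarrow> y \<in> F \<Longrightarrow> 0 < r \<Longrightarrow> r < 1 \<Longrightarrow> ((1 - r) *\<^sub>R p + r *\<^sub>R x0, r *\<^sub>R y) \<in> D"
  shows "emeasure lborel P * emeasure lborel F
      \<le> of_nat ((DIM('a) + DIM('b)) choose DIM('b)) * emeasure lborel D"
proof -
  let ?m = "DIM('a)" and ?k = "DIM('b)"
  let ?V = "emeasure lborel P"
  let ?w = "\<lambda>r. ennreal (real ?m * (1 - r) ^ (?m - 1))"
  define I where "I r y = (if 0 < r \<and> r < 1 \<and> y /\<^sub>R r \<in> F then 1 else 0 :: ennreal)" for r y
  have [measurable (raw)]: "(\<lambda>z. I (u z) (v z)) \<in> borel_measurable M"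
    if [measurable]: "u \<in> borel_measurable M" "v \<in> borel_measurable M"
    for u v and M :: "'z measure"
    unfolding I_def by measurable
  have D[measurable]: "D \<in> sets (borel \<Otimes>\<^sub>M borel)"
    unfolding borel_prod by fact
  have meas: "(\<lambda>y. \<integral>\<^sup>+r. ?w r * I r y \<partial>lborel) \<in> borel_measurable lborel"
    by (rule lborel.borel_measurable_nn_integral) (simp add: split_beta', measurable)
  have fibre: "(\<integral>\<^sup>+r. ?w r * I r y \<partial>lborel) * ?V \<le> emeasure lborel {x. (x, y) \<in> D}" for y
  proof -
    define R where "R = {r. 0 < r \<and> r < 1 \<and> y /\<^sub>R r \<in> F}"
    have "ennreal ((1 - r) ^ ?m) * ?V \<le> emeasure lborel {x. (x, y) \<in> D}" if "r \<in> R" for r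
    proof -
      have r: "0 < r" "r < 1" "y /\<^sub>R r \<in> F" using that by (auto simp: R_def)
      have "{x. (x - r *\<^sub>R x0) /\<^sub>R (1 - r) \<in> P} \<subseteq> {x. (x, y) \<in> D}"
      proof safe
        fix x assume "(x - r *\<^sub>R x0) /\<^sub>R (1 - r) \<in> P"
        from join[OF this r(3,1,2)] r show "(x, y) \<in> D" by simp
      qed
      then have "emeasure lborel {x. (x - r *\<^sub>R x0) /\<^sub>R (1 - r) \<in> P} \<le> emeasure lborel {x. (x, y) \<in> D}"
        by (rule emeasure_mono) (simp, measurable)
      then show ?thesis using r by (simp add: emeasure_lborel_homothety)
    qed
    moreover have "R \<subseteq> {0<..<1}" by (auto simp: R_def)
    ultimately have "(\<integral>\<^sup>+r. ?w r * indicator R r \<partial>lborel) * ?V \<le> emeasure lborel {x. (x, y) \<in> D}"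
      by (intro integral_power_le_of_homothety_bounds) auto
    moreover have "I r y = indicator R r" for r by (auto simp: I_def R_def)
    ultimately show ?thesis by simp
  qed
  have "(\<integral>\<^sup>+y. (\<integral>\<^sup>+r. ?w r * I r y \<partial>lborel) * ?V \<partial>lborel)
      \<le> (\<integral>\<^sup>+y. emeasure lborel {x. (x, y) \<in> D} \<partial>lborel)"
    by (intro nn_integral_mono fibre)
  also have "\<dots> = emeasure (lborel \<Otimes>\<^sub>M lborel) D"
    by (subst lborel_pair.emeasure_pair_measure_alt2) (auto simp: vimage_def)
  also have "\<dots> = emeasure lborel D" by (simp add: lborel_prod)
  finally have 1: "(\<integral>\<^sup>+y. (\<integral>\<^sup>+r. ?w r * I r y \<partial>lborel) \<partial>lborel) * ?V \<le> emeasure lborel D"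
    by (simp only: nn_integral_multc[OF meas])
  \<comment> \<open>Exchanging the integrals leaves the volume of \<open>r F\<close>, hence the factor \<open>r ^ DIM('b)\<close> of the
      beta integral.\<close>
  have "(\<integral>\<^sup>+y. (\<integral>\<^sup>+r. ?w r * I r y \<partial>lborel) \<partial>lborel)
      = (\<integral>\<^sup>+r. (\<integral>\<^sup>+y. ?w r * I r y \<partial>lborel) \<partial>lborel)"
    by (rule lborel_pair.Fubini') measurable
  also have "\<dots> = (\<integral>\<^sup>+r. (ennreal (real ?m * (1 - r) ^ (?m - 1) * r ^ ?k) * indicator {0<..<1} r)
                         * emeasure lborel F \<partial>lborel)"
  proof (rule nn_integral_cong)
    fix r :: real
    show "(\<integral>\<^sup>+y. ?w r * I r y \<partial>lborel)
        = (ennreal (real ?m * (1 - r) ^ (?m - 1) * r ^ ?k) * indicator {0<..<1} r) * emeasure lborel F"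
    proof (cases "0 < r \<and> r < 1")
      case True
      have "(\<integral>\<^sup>+y. ?w r * I r y \<partial>lborel) = ?w r * (\<integral>\<^sup>+y. indicator {y. (y - 0) /\<^sub>R r \<in> F} y \<partial>lborel)"
        using True by (subst nn_integral_cmult[symmetric])
          (auto simp: I_def indicator_def intro!: nn_integral_cong)
      also have "\<dots> = ?w r * (ennreal (r ^ ?k) * emeasure lborel F)"
        using True by (subst nn_integral_indicator) (use emeasure_lborel_homothety[of F r 0] in \<open>auto\<close>)
      finally show ?thesis using True by (simp add: ennreal_mult' mult.assoc)
    qed (auto simp: I_def)
  qed
  also have "\<dots> = (\<integral>\<^sup>+r. ennreal (real ?m * (1 - r) ^ (?m - 1) * r ^ ?k) * indicator {0<..<1} r \<partial>lborel)
                 * emeasure lborel F"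
    by (rule nn_integral_multc) measurable
  finally have 2: "of_nat ((?m + ?k) choose ?k)
      * (\<integral>\<^sup>+y. (\<integral>\<^sup>+r. ?w r * I r y \<partial>lborel) \<partial>lborel) = emeasure lborel F"
    using nn_integral_beta_nat[of ?m ?k] by (simp flip: mult.assoc)
  show ?thesis
    using mult_left_mono[OF 1, of "of_nat ((?m + ?k) choose ?k)"]
    unfolding 2[symmetric] by (simp only: mult_ac zero_le simp_thms)
qed

text \<open>A convex set differs from its closure by a null set, so the Borel set to which the previous
  lemma is applied can be the closure of \<open>L\<close>.\<close>

lemma volume_convex_join_le:
  fixes P :: "'a::euclidean_space set" and F :: "'b::euclidean_space set"
    and L :: "('a \<times> 'b) set"
  assumes [measurable]: "P \<in> sets borel" "F \<in> sets borel" and "convex L"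
    and P: "P \<times> {0} \<subseteq> L" and F: "{x0} \<times> F \<subseteq> L"
  shows "emeasure lborel P * emeasure lborel F
      \<le> of_nat ((DIM('a) + DIM('b)) choose DIM('b)) * emeasure lebesgue L"
proof -
  have null: "frontier L \<in> null_sets lebesgue"
    using negligible_convex_frontier[OF \<open>convex L\<close>] by (simp add: negligible_iff_null_sets)
  have "AE z in lebesgue. z \<in> closure L \<longleftrightarrow> z \<in> L"
    using closure_subset interior_subset
    by (intro AE_I'[OF null]) (auto simp: frontier_def)
  moreover have "L \<in> sets lebesgue"
  proof -
    have "L - interior L \<in> sets lebesgue"
      using negligible_convex_frontier[OF \<open>convex L\<close>] closure_subset
      by (intro negligible_imp_sets, elim negligible_subset) (auto simp: frontier_def)
    then have "interior L \<union> (L - interior L) \<in> sets lebesgue"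
      by (intro sets.Un) auto
    then show ?thesis using interior_subset[of L] by (simp add: Un_absorb1)
  qed
  ultimately have eq: "emeasure lebesgue (closure L) = emeasure lebesgue L"
    by (intro emeasure_eq_AE) (auto intro: lmeasurable_closure)
  have "emeasure lborel P * emeasure lborel F
      \<le> of_nat ((DIM('a) + DIM('b)) choose DIM('b)) * emeasure lborel (closure L)"
  proof (rule volume_join_le)
    fix p y and r :: real assume *: "p \<in> P" "y \<in> F" "0 < r" "r < 1"
    have "(1 - r) *\<^sub>R (p, 0) + r *\<^sub>R (x0, y) \<in> L"
      using * P F by (intro convexD[OF \<open>convex L\<close>]) auto
    then show "((1 - r) *\<^sub>R p + r *\<^sub>R x0, r *\<^sub>R y) \<in> closure L"
      using closure_subset by auto
  qed auto
  then show ?thesis by (simp add: eq emeasure_completion flip: eq)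
qed

section \<open>Weighted Lebesgue measures and Borel minorants\<close>

text \<open>A finite essential supremum carries measurability, since that of a non-measurable function
  is infinite by convention.\<close>

lemma linf_norm_eq_erealD:
  assumes "linf_norm f = ereal c"
  shows "f \<in> borel_measurable lebesgue" "AE x in lebesgue. f x \<le> c"
proof -
  have "(\<lambda>x. ereal (f x)) \<in> borel_measurable lebesgue"
  proof (rule ccontr)
    assume "(\<lambda>x. ereal (f x)) \<notin> borel_measurable lebesgue"
    then have "linf_norm f = top"
      unfolding linf_norm_def by (rule esssup_non_measurable)
    with assms show False by (simp add: top_ereal_def)
  qed
  then show "f \<in> borel_measurable lebesgue"
    by simp
  show "AE x in lebesgue. f x \<le> c"
    using esssup_AE[where f = "\<lambda>x. ereal (f x)" and M = lebesgue] assms by (simp add: linf_norm_def)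
qed

text \<open>Modify a Borel version to be \<open>0\<close> on a Borel null set that contains all points where
  it disagrees with \<open>f\<close> or where \<open>f\<close> exceeds the bound \<open>c\<close>.\<close>

lemma borel_minorant_AE_eq:
  fixes f :: "'a::euclidean_space \<Rightarrow> real"
  assumes f: "f \<in> borel_measurable lebesgue" "AE x in lebesgue. f x \<le> c"
    and nonneg: "\<And>x. 0 \<le> f x" and "0 \<le> c"
  obtains h where "h \<in> borel_measurable borel" "\<And>x. 0 \<le> h x" "\<And>x. h x \<le> f x" "\<And>x. h x \<le> c"
    "AE x in lborel. h x = f x"
proof -
  obtain g where [measurable]: "g \<in> borel_measurable lborel" and g: "AE x in lborel. f x = g x"
    using completion_ex_borel_measurable_real[OF f(1)] by auto
  have "AE x in lborel. f x = g x \<and> f x \<le> c"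
    using g f(2) by (simp add: AE_completion_iff)
  then obtain N where N: "N \<in> null_sets lborel" "\<And>x. x \<notin> N \<Longrightarrow> f x = g x \<and> f x \<le> c"
    by (auto simp: eventually_ae_filter)
  have [measurable]: "N \<in> sets borel" using N(1) by auto
  show thesis
  proof (rule that[of "\<lambda>x. if x \<in> N then 0 else g x"])
    show "(\<lambda>x. if x \<in> N then 0 else g x) \<in> borel_measurable borel" by measurable
    show "AE x in lborel. (if x \<in> N then 0 else g x) = f x"
      using AE_not_in[OF N(1)] by eventually_elim (use N(2) in auto)
    show "0 \<le> (if x \<in> N then 0 else g x)" "(if x \<in> N then 0 else g x) \<le> f x"
      "(if x \<in> N then 0 else g x) \<le> c" for x
      using N(2)[of x] nonneg[of x] \<open>0 \<le> c\<close> by auto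
  qed
qed

lemma sigma_finite_lebesgue: "sigma_finite_measure (lebesgue :: 'a::euclidean_space measure)"
proof
  obtain A where A: "countable A" "A \<subseteq> sets (lborel :: 'a measure)" "\<Union>A = space lborel"
    "\<forall>a\<in>A. emeasure lborel a \<noteq> \<infinity>"
    using lborel.sigma_finite_countable by blast
  then show "\<exists>A::'a set set. countable A \<and> A \<subseteq> sets lebesgue \<and> \<Union>A = space lebesgue
      \<and> (\<forall>a\<in>A. emeasure lebesgue a \<noteq> \<infinity>)"
    by (intro exI[of _ A]) (auto simp: emeasure_completion subset_iff)
qed

lemma AE_lborel_pairI:
  assumes "AE x in lborel. Q x" "AE y in lborel. R y"
  shows "AE z in lborel \<Otimes>\<^sub>M lborel. Q (fst z) \<and> R (snd z)"
proof -
  obtain N M where N: "N \<in> null_sets lborel" "\<And>x. x \<notin> N \<Longrightarrow> Q x"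
    and M: "M \<in> null_sets lborel" "\<And>y. y \<notin> M \<Longrightarrow> R y"
    using assms by (auto simp: eventually_ae_filter)
  have [measurable]: "N \<in> sets borel" "M \<in> sets borel" using N(1) M(1) by auto
  have "AE z in lborel \<Otimes>\<^sub>M lborel. fst z \<notin> N \<and> snd z \<notin> M"
  proof (rule lborel_pair.AE_pair_measure)
    show "{z \<in> space (lborel \<Otimes>\<^sub>M lborel). fst z \<notin> N \<and> snd z \<notin> M} \<in> sets (lborel \<Otimes>\<^sub>M lborel)"
      by measurable
    show "AE x in lborel. AE y in lborel. fst (x, y) \<notin> N \<and> snd (x, y) \<notin> M"
      using AE_not_in[OF N(1)] AE_not_in[OF M(1)] by auto
  qed
  then show ?thesis by eventually_elim (use N M in auto)
qed

lemma emeasure_weighted: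
  fixes f h :: "'a::euclidean_space \<Rightarrow> real"
  assumes f[measurable]: "f \<in> borel_measurable lebesgue" and eq: "AE x in lborel. h x = f x"
    and A: "A \<in> sets borel"
  shows "emeasure (weighted f) A = (\<integral>\<^sup>+x\<in>A. ennreal (h x) \<partial>lborel)"
proof -
  have "emeasure (weighted f) A = (\<integral>\<^sup>+x\<in>A. ennreal (f x) \<partial>lebesgue)"
    unfolding weighted_def using A by (intro emeasure_density) auto
  also have "\<dots> = (\<integral>\<^sup>+x\<in>A. ennreal (h x) \<partial>lborel)"
    unfolding nn_integral_completion
    by (rule nn_integral_cong_AE) (use eq in eventually_elim, simp)
  finally show ?thesis .
qed

text \<open>Reduces the product of two measures on completed \<open>\<sigma>\<close>-algebras to an integral against
  Borel Lebesgue measure on the product space, where the layer-cake formula is available.\<close>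

lemma emeasure_weighted_pair:
  fixes f h :: "'a::euclidean_space \<Rightarrow> real" and g l :: "'b::euclidean_space \<Rightarrow> real"
  assumes f[measurable]: "f \<in> borel_measurable lebesgue" and g[measurable]: "g \<in> borel_measurable lebesgue"
    and [measurable]: "h \<in> borel_measurable borel" "l \<in> borel_measurable borel"
    and fh: "AE x in lborel. h x = f x" and gl: "AE y in lborel. l y = g y"
    and nonneg: "\<And>x. 0 \<le> h x"  "\<And>y. 0 \<le> l y"
    and C: "C \<in> sets (borel :: ('a \<times> 'b) measure)"
  shows "emeasure (weighted f \<Otimes>\<^sub>M weighted g) C = (\<integral>\<^sup>+z\<in>C. ennreal (h (fst z) * l (snd z)) \<partial>lborel)"
proof -
  have C'[measurable]: "C \<in> sets (borel \<Otimes>\<^sub>M borel)" unfolding borel_prod by (fact C)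
  interpret G: sigma_finite_measure "weighted g"
    unfolding weighted_def
    by (subst sigma_finite_measure.sigma_finite_iff_density_finite[OF sigma_finite_lebesgue]) auto
  have "sets (borel \<Otimes>\<^sub>M borel :: ('a \<times> 'b) measure) \<subseteq> sets (lebesgue \<Otimes>\<^sub>M lebesgue)"
    by (rule sets_pair_in_sets) auto
  also have "sets (lebesgue \<Otimes>\<^sub>M lebesgue :: ('a \<times> 'b) measure) = sets (weighted f \<Otimes>\<^sub>M weighted g)"
    by (rule sets_pair_measure_cong) (auto simp: weighted_def)
  finally have "C \<in> sets (weighted f \<Otimes>\<^sub>M weighted g)" using C' by auto
  then have "emeasure (weighted f \<Otimes>\<^sub>M weighted g) C = (\<integral>\<^sup>+x. emeasure (weighted g) (Pair x -` C) \<partial>weighted f)"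
    by (rule G.emeasure_pair_measure_alt)
  also have "\<dots> = (\<integral>\<^sup>+x. (\<integral>\<^sup>+y. ennreal (l y) * indicator C (x, y) \<partial>lborel) \<partial>weighted f)"
    by (intro nn_integral_cong, subst emeasure_weighted[OF g gl])
       (auto intro!: nn_integral_cong simp: indicator_def measurable_sets_borel sets_Pair1[OF C'])
  also have "\<dots> = (\<integral>\<^sup>+x. ennreal (f x) * (\<integral>\<^sup>+y. ennreal (l y) * indicator C (x, y) \<partial>lborel) \<partial>lebesgue)"
    unfolding weighted_def
  proof (rule nn_integral_density)
    have "(\<lambda>x. \<integral>\<^sup>+y. ennreal (l y) * indicator C (x, y) \<partial>lborel) \<in> borel_measurable lborel"
      by measurable
    then show "(\<lambda>x. \<integral>\<^sup>+y. ennreal (l y) * indicator C (x, y) \<partial>lborel) \<in> borel_measurable lebesgue"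
      by (rule measurable_completion)
  qed auto
  also have "\<dots> = (\<integral>\<^sup>+x. ennreal (h x) * (\<integral>\<^sup>+y. ennreal (l y) * indicator C (x, y) \<partial>lborel) \<partial>lborel)"
    unfolding nn_integral_completion
    by (rule nn_integral_cong_AE) (use fh in eventually_elim, simp)
  also have "\<dots> = (\<integral>\<^sup>+x. \<integral>\<^sup>+y. ennreal (h x * l y) * indicator C (x, y) \<partial>lborel \<partial>lborel)"
    using nonneg by (simp add: nn_integral_cmult[symmetric] ennreal_mult mult.assoc)
  also have "\<dots> = (\<integral>\<^sup>+z\<in>C. ennreal (h (fst z) * l (snd z)) \<partial>(lborel \<Otimes>\<^sub>M lborel))"
    by (subst lborel.nn_integral_fst[symmetric]) auto
  finally show ?thesis by (simp only: lborel_prod)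
qed

section \<open>Orthogonal projections in orthonormal coordinates\<close>

lemma orth_proj_eqI:
  assumes "subspace H" "p \<in> H" "z - p \<in> orthogonal_comp H"
  shows "orth_proj H z = p"
  unfolding orth_proj_def
proof (rule the_equality)
  fix q assume q: "q \<in> H \<and> z - q \<in> orthogonal_comp H"
  from q assms(3) have "(z - p) - (z - q) \<in> orthogonal_comp H"
    by (metis subspace_diff subspace_orthogonal_comp)
  moreover have "q - p \<in> H" using q assms(1,2) by (intro subspace_diff) auto
  ultimately have "orthogonal (q - p) (q - p)"
    by (simp add: orthogonal_comp_def)
  then show "q = p" by (simp add: orthogonal_self)
qed (use assms in simp)

lemma orth_proj_orthonormal_coords:
  assumes "orthonormal_coords H \<iota>" "subspace H"
  shows "orth_proj H (\<iota> (x, y)) = \<iota> (x, 0)"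
proof (rule orth_proj_eqI[OF \<open>subspace H\<close>])
  show "\<iota> (x, 0) \<in> H"
    using assms(1) by (auto simp: orthonormal_coords_def)
  have "\<iota> (x, y) - \<iota> (x, 0) = \<iota> ((x, y) - (x, 0))"
    using assms(1) by (simp only: orthonormal_coords_def linear_diff)
  also have "\<dots> = \<iota> (0, y)" by simp
  also have "\<dots> \<in> orthogonal_comp H"
    using assms(1) by (auto simp: orthonormal_coords_def)
  finally show "\<iota> (x, y) - \<iota> (x, 0) \<in> orthogonal_comp H" .
qed

section \<open>The Rogers-Shephard inequality for quasi-concave product densities\<close>

text \<open>The bound on \<open>f\<close> has to hold everywhere because \<open>f x0\<close> occurs as a value at a single point,
  whereas \<open>g\<close> is only ever integrated. The final division by \<open>f 0 * g 0\<close> is legitimate because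
  the left-hand side is \<open>0\<close> as soon as one of these two values vanishes.\<close>

lemma weighted_rogers_shephard:
  fixes f :: "'a::euclidean_space \<Rightarrow> real" and g :: "'b::euclidean_space \<Rightarrow> real"
    and C :: "('a \<times> 'b) set"
  assumes f: "f \<in> borel_measurable lebesgue" "\<And>x. 0 \<le> f x" "\<And>x. f x \<le> f 0"
    and g: "g \<in> borel_measurable lebesgue" "\<And>y. 0 \<le> g y" "AE y in lebesgue. g y \<le> g 0"
    and qc: "quasi_concave (\<lambda>(x, y). f x * g y)"
    and C: "closed C" "convex C" "\<And>x y. (x, y) \<in> C \<Longrightarrow> (x, 0) \<in> C"
  shows "emeasure (weighted f) {x. (x, 0) \<in> C} *
           (ennreal (f x0 / f 0) * emeasure (weighted g) {y. (x0, y) \<in> C})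
         \<le> of_nat ((DIM('a) + DIM('b)) choose DIM('b)) * emeasure (weighted f \<Otimes>\<^sub>M weighted g) C"
proof (cases "f 0 = 0 \<or> g 0 = 0")
  case True
  have sec: "{y. (x0, y) \<in> C} \<in> sets borel"
    using closed_vimage[OF \<open>closed C\<close>, of "Pair x0"]
    by (simp add: vimage_def continuous_on_Pair)
  from True show ?thesis
  proof
    assume "g 0 = 0"
    with g(2,3) have "AE y in lborel. 0 = g y"
      by (auto simp: AE_completion_iff antisym elim: eventually_mono)
    then have "emeasure (weighted g) {y. (x0, y) \<in> C} = 0"
      by (subst emeasure_weighted[OF g(1) _ sec, of "\<lambda>_. 0"]) auto
    then show ?thesis by simp
  qed simp
next
  case False
  then have pos: "0 < f 0" "0 < g 0" using f(2)[of 0] g(2)[of 0] by linarith+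
  \<comment> \<open>Minorants rather than arbitrary Borel versions: the superlevel sets of \<open>h\<close> and \<open>l\<close> then lie
      inside those of \<open>f\<close> and \<open>g\<close>, whose convexity comes from quasi-concavity.\<close>
  obtain h where [measurable]: "h \<in> borel_measurable borel"
    and h: "\<And>x. 0 \<le> h x" "\<And>x. h x \<le> f x" "AE x in lborel. h x = f x"
    using borel_minorant_AE_eq[OF f(1) AE_I2[OF f(3)] f(2) f(2)] by metis
  obtain l where [measurable]: "l \<in> borel_measurable borel"
    and l: "\<And>y. 0 \<le> l y" "\<And>y. l y \<le> g y" "\<And>y. l y \<le> g 0" "AE y in lborel. l y = g y"
    using borel_minorant_AE_eq[OF g(1,3,2) g(2)] by metis
  have Cm[measurable]: "C \<in> sets borel" using \<open>closed C\<close> by simp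
  have Cm'[measurable]: "C \<in> sets (borel \<Otimes>\<^sub>M borel)" unfolding borel_prod by (fact Cm)
  define P where "P = {x. (x, 0::'b) \<in> C}"
  define F where "F = {y. (x0, y) \<in> C}"
  have [measurable]: "P \<in> sets borel" "F \<in> sets borel" unfolding P_def F_def by measurable
  define T where "T = f 0 * g 0"
  define b :: ennreal where "b = of_nat ((DIM('a) + DIM('b)) choose DIM('b) :: nat)"
  define A where "A s = {x\<in>P. s \<le> h x * g 0}" for s
  define B where "B s = {y\<in>F. s \<le> f x0 * l y}" for s
  define w where "w z = h (fst z) * l (snd z)" for z
  have [measurable]: "w \<in> borel_measurable borel"
    unfolding w_def borel_prod[symmetric] by measurable
  define E where "E s = {z\<in>C. s \<le> w z}" for s

  have Em: "E s \<in> sets borel" for s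
    unfolding E_def by measurable
  \<comment> \<open>The inequality on each level: \<open>A s\<close> and \<open>B s\<close> sit in the convex set \<open>L\<close> as a horizontal and a
      vertical slice, at the height \<open>0\<close> and over the point \<open>x0\<close>.\<close>
  have level: "emeasure lborel (A s) * emeasure lborel (B s) \<le> b * emeasure lborel (E s)" for s
  proof -
    define L where "L = {z\<in>C. s \<le> f (fst z) * g (snd z)}"
    have "convex L"
      unfolding convex_alt
    proof (intro ballI allI impI)
      fix z w and u :: real assume zw: "z \<in> L" "w \<in> L" and u: "0 \<le> u \<and> u \<le> 1"
      show "(1 - u) *\<^sub>R z + u *\<^sub>R w \<in> L"
      proof (cases "u = 0 \<or> u = 1")
        case False
        then have "u \<in> {0<..<1}" using u by auto
        then have "min (f (fst z) * g (snd z)) (f (fst w) * g (snd w))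
            \<le> f (fst ((1 - u) *\<^sub>R z + u *\<^sub>R w)) * g (snd ((1 - u) *\<^sub>R z + u *\<^sub>R w))"
          using qc unfolding quasi_concave_def by (metis (mono_tags, lifting) case_prod_beta)
        moreover have "(1 - u) *\<^sub>R z + u *\<^sub>R w \<in> C"
          using zw u \<open>convex C\<close> by (auto simp: L_def convex_alt)
        ultimately show ?thesis using zw by (auto simp: L_def)
      qed (use zw in auto)
    qed
    moreover have "A s \<times> {0} \<subseteq> L"
      using mult_right_mono[OF h(2) g(2)] by (auto simp: A_def P_def L_def intro: order_trans)
    moreover have "{x0} \<times> B s \<subseteq> L"
      using mult_left_mono[OF l(2) f(2)] by (auto simp: B_def F_def L_def intro: order_trans)
    moreover have "A s \<in> sets borel" "B s \<in> sets borel"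
      unfolding A_def B_def by measurable
    ultimately have "emeasure lborel (A s) * emeasure lborel (B s) \<le> b * emeasure lebesgue L"
      unfolding b_def by (intro volume_convex_join_le) auto
    also have "emeasure lebesgue L \<le> emeasure lebesgue (E s)"
    proof (rule emeasure_mono_AE)
      have "AE z in lborel \<Otimes>\<^sub>M lborel. h (fst z) = f (fst z) \<and> l (snd z) = g (snd z)"
        using h(3) l(4) by (rule AE_lborel_pairI)
      then have "AE z in lebesgue. h (fst z) = f (fst z) \<and> l (snd z) = g (snd z)"
        unfolding lborel_prod by (rule AE_completion)
      then show "AE z in lebesgue. z \<in> L \<longrightarrow> z \<in> E s"
        by eventually_elim (auto simp: L_def E_def w_def)
      show "E s \<in> sets lebesgue" using Em by simp
    qed
    also have "emeasure lebesgue (E s) = emeasure lborel (E s)"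
      using Em by simp
    finally show ?thesis by (simp add: mult_left_mono)
  qed

  \<comment> \<open>\<open>T\<close> bounds all three functions, so that the three layer-cake formulas run over the same
      interval, as the Chebyshev inequality requires.\<close>
  have hT: "h x * g 0 \<le> T" "f x0 * l y \<le> T" "h x * l y \<le> T" for x y
    using h(1,2)[of x] f(2,3)[of x] f(2,3)[of x0] l(1,3)[of y] pos
    unfolding T_def by (auto intro!: mult_mono intro: order_trans)
  have IA: "ennreal (g 0) * emeasure (weighted f) P = (\<integral>\<^sup>+s\<in>{0<..T}. emeasure lborel (A s) \<partial>lborel)"
  proof -
    have "ennreal (g 0) * emeasure (weighted f) P = (\<integral>\<^sup>+x\<in>P. ennreal (h x * g 0) \<partial>lborel)"
      using h(1) pos by (subst emeasure_weighted[OF f(1) h(3)])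
        (auto simp: nn_integral_cmult[symmetric] ennreal_mult mult_ac)
    then show ?thesis unfolding A_def
      using h(1) pos hT by (subst (asm) nn_integral_layer_cake) auto
  qed
  have IB: "ennreal (f x0) * emeasure (weighted g) F = (\<integral>\<^sup>+s\<in>{0<..T}. emeasure lborel (B s) \<partial>lborel)"
  proof -
    have "ennreal (f x0) * emeasure (weighted g) F = (\<integral>\<^sup>+y\<in>F. ennreal (f x0 * l y) \<partial>lborel)"
      using l(1) f(2) by (subst emeasure_weighted[OF g(1) l(4)])
        (auto simp: nn_integral_cmult[symmetric] ennreal_mult mult_ac)
    then show ?thesis unfolding B_def
      using l(1) f(2) hT by (subst (asm) nn_integral_layer_cake) auto
  qed
  have IE: "emeasure (weighted f \<Otimes>\<^sub>M weighted g) C = (\<integral>\<^sup>+s\<in>{0<..T}. emeasure lborel (E s) \<partial>lborel)"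
  proof -
    have "emeasure (weighted f \<Otimes>\<^sub>M weighted g) C = (\<integral>\<^sup>+z\<in>C. ennreal (w z) \<partial>lborel)"
      unfolding w_def using h l f(1) g(1) by (intro emeasure_weighted_pair) auto
    also have "\<dots> = (\<integral>\<^sup>+s\<in>{0<..T}. emeasure lborel (E s) \<partial>lborel)"
      unfolding E_def
    proof (rule nn_integral_layer_cake)
      show "0 \<le> w z" "w z \<le> T" for z
        using h(1) l(1) hT(3) by (simp_all add: w_def)
    qed measurable
    finally show ?thesis .
  qed
  have [measurable]: "(\<lambda>s. emeasure lborel (A s)) \<in> borel_measurable borel"
    "(\<lambda>s. emeasure lborel (B s)) \<in> borel_measurable borel"
    unfolding A_def B_def by measurable
  have [measurable]: "(\<lambda>s. emeasure lborel (E s)) \<in> borel_measurable borel"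
    unfolding E_def by measurable

  let ?mf = "emeasure (weighted f) P" and ?mg = "emeasure (weighted g) F"
  have "(ennreal (g 0) * ?mf) * (ennreal (f x0) * ?mg)
      \<le> ennreal T * (\<integral>\<^sup>+s\<in>{0<..T}. emeasure lborel (A s) * emeasure lborel (B s) \<partial>lborel)"
    unfolding IA IB
  proof (rule nn_integral_chebyshev_antimono)
    show "antimono (\<lambda>s. emeasure lborel (A s))" "antimono (\<lambda>s. emeasure lborel (B s))"
      by (auto intro!: antimonoI emeasure_mono simp: A_def B_def)
  qed (use pos in \<open>auto simp: T_def\<close>)
  also have "\<dots> \<le> ennreal T * (\<integral>\<^sup>+s\<in>{0<..T}. b * emeasure lborel (E s) \<partial>lborel)"
    by (intro mult_left_mono nn_integral_mono mult_right_mono level) auto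
  also have "\<dots> = ennreal T * (b * emeasure (weighted f \<Otimes>\<^sub>M weighted g) C)"
    unfolding IE by (simp add: nn_integral_cmult mult.assoc)
  finally have main: "(ennreal (g 0) * ?mf) * (ennreal (f x0) * ?mg)
      \<le> ennreal T * (b * emeasure (weighted f \<Otimes>\<^sub>M weighted g) C)" .
  have "ennreal (1 / T) * (ennreal T * X) = X" for X
    using pos by (simp add: T_def flip: mult.assoc ennreal_mult')
  moreover have "ennreal (1 / T) * ((ennreal (g 0) * ?mf) * (ennreal (f x0) * ?mg))
      = ?mf * (ennreal (f x0 / f 0) * ?mg)"
  proof -
    have "ennreal (f x0 / f 0) = ennreal (1 / T) * ennreal (g 0) * ennreal (f x0)"
      using pos f(2) by (simp add: T_def flip: ennreal_mult')
    then show ?thesis by (simp add: mult_ac)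
  qed
  ultimately show ?thesis
    using mult_left_mono[OF main, of "ennreal (1 / T)"] unfolding P_def F_def b_def by simp
qed

theorem theorem4p1:
  fixes n k :: nat
    and H K :: "'c::euclidean_space set"
    and \<iota> :: "'a::euclidean_space \<times> 'b::euclidean_space \<Rightarrow> 'c"
    and \<phi>H :: "'a \<Rightarrow> real" and \<phi>P :: "'b \<Rightarrow> real" and \<phi> :: "'c \<Rightarrow> real"
  assumes "DIM('c) = n" and "k \<in> {1..n - 1}"
    and "DIM('a) = n - k" and "DIM('b) = k"
    and "subspace H" and "dim H = n - k"
    and "orthonormal_coords H \<iota>"
    and "\<And>x. \<phi>H x \<ge> 0" and "\<And>y. \<phi>P y \<ge> 0"
    and "linf_norm \<phi>H = ereal (\<phi>H 0)" and "linf_norm \<phi>P = ereal (\<phi>P 0)"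
    and "\<And>x. \<phi>H x \<le> \<phi>H 0"
    and "\<And>x y. \<phi> (\<iota> (x, y)) = \<phi>H x * \<phi>P y"
    and "quasi_concave \<phi>"
    and "convex_body K" and "orth_proj H ` K \<subseteq> K"
    and "\<And>t. t \<in> {0<..<1} \<Longrightarrow>
           \<exists>x0. \<forall>x. emeasure lebesgue (fibre \<iota> (level_set t \<phi> \<inter> K) x)
                     \<le> emeasure lebesgue (fibre \<iota> (level_set t \<phi> \<inter> K) x0)"
  shows "emeasure (weighted \<phi>H) {x. \<iota> (x, 0) \<in> orth_proj H ` K} *
           (SUP x0. ennreal (\<phi>H x0 / real_of_ereal (linf_norm \<phi>H)) *
                    emeasure (weighted \<phi>P) (fibre \<iota> K x0))
         \<le> of_nat (n choose k) *
            emeasure (weighted \<phi>H \<Otimes>\<^sub>M weighted \<phi>P) (\<iota> -` K)"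
proof -
  define C where "C = \<iota> -` K"
  have lin: "linear \<iota>" using assms(7) by (simp add: orthonormal_coords_def)
  have C: "closed C" "convex C"
    unfolding C_def using assms(15) lin
    by (auto simp: convex_body_def compact_imp_closed intro!: closed_vimage convex_linear_vimage
        linear_continuous_on linear_conv_bounded_linear[THEN iffD1])
  have proj: "(x, 0) \<in> C" if "(x, y) \<in> C" for x y
    using that assms(16) orth_proj_orthonormal_coords[OF assms(7,5), of x y]
    by (force simp: C_def)
  have qc: "quasi_concave (\<lambda>(x, y). \<phi>H x * \<phi>P y)"
    unfolding quasi_concave_def
  proof (intro allI ballI)
    fix z w :: "'a \<times> 'b" and u :: real assume "u \<in> {0<..<1}"
    then have "min (\<phi> (\<iota> z)) (\<phi> (\<iota> w)) \<le> \<phi> ((1 - u) *\<^sub>R \<iota> z + u *\<^sub>R \<iota> w)"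
      using assms(14) by (simp add: quasi_concave_def)
    also have "(1 - u) *\<^sub>R \<iota> z + u *\<^sub>R \<iota> w = \<iota> ((1 - u) *\<^sub>R z + u *\<^sub>R w)"
      using lin by (simp only: linear_add linear_scale)
    finally show "min (case z of (x, y) \<Rightarrow> \<phi>H x * \<phi>P y) (case w of (x, y) \<Rightarrow> \<phi>H x * \<phi>P y)
        \<le> (case (1 - u) *\<^sub>R z + u *\<^sub>R w of (x, y) \<Rightarrow> \<phi>H x * \<phi>P y)"
      by (simp add: split_beta scaleR_prod_def plus_prod_def flip: assms(13))
  qed
  note \<phi>H = linf_norm_eq_erealD[OF assms(10)] and \<phi>P = linf_norm_eq_erealD[OF assms(11)]
  have n: "n = DIM('a) + DIM('b)" using assms(2-4) by auto
  \<comment> \<open>As \<open>K\<close> contains its projection, the projection can be replaced by a section of \<open>K\<close>, which is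
      closed and therefore measurable.\<close>
  have P: "emeasure (weighted \<phi>H) {x. \<iota> (x, 0) \<in> orth_proj H ` K}
      \<le> emeasure (weighted \<phi>H) {x. (x, 0) \<in> C}"
  proof (rule emeasure_mono)
    have "closed ((\<lambda>x. (x, 0)) -` C)"
      by (intro closed_vimage C continuous_intros)
    then show "{x. (x, 0) \<in> C} \<in> sets (weighted \<phi>H)"
      by (simp add: weighted_def vimage_def)
  qed (use assms(16) in \<open>auto simp: C_def\<close>)
  show ?thesis
    unfolding SUP_mult_left_ennreal
  proof (rule SUP_least)
    fix x0
    have "emeasure (weighted \<phi>H) {x. (x, 0) \<in> C} *
        (ennreal (\<phi>H x0 / \<phi>H 0) * emeasure (weighted \<phi>P) {y. (x0, y) \<in> C})
      \<le> of_nat ((DIM('a) + DIM('b)) choose DIM('b)) * emeasure (weighted \<phi>H \<Otimes>\<^sub>M weighted \<phi>P) C"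
      using \<phi>H(1) assms(8,12) \<phi>P(1) assms(9) \<phi>P(2) qc C proj
      by (rule weighted_rogers_shephard)
    then show "emeasure (weighted \<phi>H) {x. \<iota> (x, 0) \<in> orth_proj H ` K} *
         (ennreal (\<phi>H x0 / real_of_ereal (linf_norm \<phi>H)) * emeasure (weighted \<phi>P) (fibre \<iota> K x0))
       \<le> of_nat (n choose k) * emeasure (weighted \<phi>H \<Otimes>\<^sub>M weighted \<phi>P) (\<iota> -` K)"
      using mult_right_mono[OF P] n assms(4,10) by (auto simp: C_def fibre_def intro: order_trans)
  qed
qed

end
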